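(* For every even integer $k\ge 4$ and every prime $p>k$, there is a coloring $c$ of $\mathbb{Z}/p^{k^2/4}\mathbb{Z}$ using at most $(k-1)^{k^2/4-1}\,p$ colors such that there is no nontrivial symmetrically colored $k$-term arithmetic progression in $\mathbb{Z}/p^{k^2/4}\mathbb{Z}$.
   Context: An $r$-coloring of a set is a map from it to a set of at most $r$ colors. For an even integer $k\ge 4$, a $k$-term arithmetic progression ($k$-AP) in an abelian group $G$ is a sequence $a, a+d, \ldots, a+(k-1)d$ with $a,d\in G$; it is nontrivial if $d\neq 0$ in $G$. Given a coloring $c$ of $G$, the $k$-AP is symmetrically colored if $c(a+(i-1)d)=c(a+(k-i)d)$ for every $i\in\{1,\ldots,k/2\}$. *)

theory Defs
  imports "HOL-Algebra.Elementary_Groups" "HOL-Computational_Algebra.Primes"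
begin

definition is_coloring :: "nat \<Rightarrow> 'a set \<Rightarrow> ('a \<Rightarrow> 'c) \<Rightarrow> bool" where
  "is_coloring r S c \<longleftrightarrow> (\<exists>C. finite C \<and> card C \<le> r \<and> c \<in> S \<rightarrow> C)"

text \<open>Abelian groups are HOL-Algebra records, hence written multiplicatively: the term
  \<open>a + i d\<close> of a progression appears as \<open>a \<otimes> d [^] i\<close>, and \<open>d \<noteq> 0\<close> as \<open>d \<noteq> \<one>\<close>.\<close>

definition ap_term :: "('a, 'b) monoid_scheme \<Rightarrow> 'a \<Rightarrow> 'a \<Rightarrow> nat \<Rightarrow> 'a" where
  "ap_term G a d i = a \<otimes>\<^bsub>G\<^esub> d [^]\<^bsub>G\<^esub> i"

definition symmetrically_colored ::
    "('a, 'b) monoid_scheme \<Rightarrow> ('a \<Rightarrow> 'c) \<Rightarrow> nat \<Rightarrow> 'a \<Rightarrow> 'a \<Rightarrow> bool" where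
  "symmetrically_colored G c k a d \<longleftrightarrow>
     (\<forall>i\<in>{1..k div 2}. c (ap_term G a d (i - 1)) = c (ap_term G a d (k - i)))"

definition has_nontrivial_symmetrically_colored_AP ::
    "('a, 'b) monoid_scheme \<Rightarrow> ('a \<Rightarrow> 'c) \<Rightarrow> nat \<Rightarrow> bool" where
  "has_nontrivial_symmetrically_colored_AP G c k \<longleftrightarrow>
     (\<exists>a\<in>carrier G. \<exists>d\<in>carrier G. d \<noteq> \<one>\<^bsub>G\<^esub> \<and> symmetrically_colored G c k a d)"

end

(* Write k = 2h and let m = h^2 = 1 + 3 + ... + (k-1). The colour of x records, for 0 < s < m, which of
   k-1 equal arcs of Z/p^s contains x mod p^s, and one value f(x) in F_p. If a progression is
   symmetrically coloured, the arcs forbid wrap-around, so each x_i mod p^s is an arithmetic progression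
   of integers and the digit vectors of the x_i form an arithmetic progression in F_p^m. Group the
   digits into blocks of sizes 1, 3, ..., k-1 and let f be the sum over the blocks of the norm forms
   F_{p^r} -> F_p. As these are anisotropic, i |-> f(x_i) is a polynomial of odd degree D < k, where D
   is the size of the largest block on which the step is nonzero. Such a polynomial is not symmetric
   about the midpoint of 0, ..., k-1: its D-th difference is a nonzero constant which the reflection
   negates. *)

theory Submission
  imports Defs "HOL-Computational_Algebra.Polynomial" "HOL-Number_Theory.Cong"
begin

section \<open>Finite differences\<close>

definition fdiff :: "(nat \<Rightarrow> 'a::comm_ring_1) \<Rightarrow> nat \<Rightarrow> 'a" where
  "fdiff f i = f (Suc i) - f i"

lemma funpow_fdiff_sum:
  "(fdiff ^^ n) (\<lambda>i. \<Sum>x\<in>A. f x i) = (\<lambda>i. \<Sum>x\<in>A. (fdiff ^^ n) (f x) i)"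
  by (induction n) (auto simp: fdiff_def sum_subtractf fun_eq_iff)

lemma funpow_fdiff_const: "n > 0 \<Longrightarrow> (fdiff ^^ n) (\<lambda>_. c) = (\<lambda>_. 0)"
proof (induction n)
  case (Suc n)
  then show ?case by (cases "n = 0") (auto simp: fdiff_def fun_eq_iff)
qed simp

text \<open>Leibniz rule with a linear factor: its second difference vanishes, so only two terms
  remain, and the term that differences the linear factor sees \<open>f\<close> shifted by
  one.\<close>

lemma funpow_fdiff_linear_mult:
  "(fdiff ^^ n) (\<lambda>i. (a + of_nat i * b) * f i) i =
     (a + of_nat i * b) * (fdiff ^^ n) f i + of_nat n * b * (fdiff ^^ (n - 1)) f (Suc i)"
proof (induction n arbitrary: i)
  case (Suc n)
  let ?g = "\<lambda>i. (a + of_nat i * b) * f i"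
  have "(fdiff ^^ Suc n) ?g i = (fdiff ^^ n) ?g (Suc i) - (fdiff ^^ n) ?g i"
    by (simp add: fdiff_def)
  also have "\<dots> = (a + of_nat i * b) * (fdiff ^^ Suc n) f i + of_nat (Suc n) * b * (fdiff ^^ n) f (Suc i)"
    unfolding Suc.IH by (cases n) (simp_all add: fdiff_def algebra_simps)
  finally show ?case by simp
qed simp

text \<open>A product of \<open>n\<close> linear factors is a polynomial in \<open>i\<close> of
  degree at most \<open>n\<close> whose coefficient at \<open>n\<close> is the product of the
  slopes. By induction, the Leibniz rule leaves only the term containing \<open>b n\<close>, because
  the next difference of the shorter product is 0.\<close>

lemma funpow_fdiff_prod_linear:
  "(fdiff ^^ n) (\<lambda>i. \<Prod>s<n. a s + of_nat i * b s) = (\<lambda>_. fact n * (\<Prod>s<n. b s))"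
proof (induction n)
  case (Suc n)
  have "(fdiff ^^ Suc n) (\<lambda>i. \<Prod>s<n. a s + of_nat i * b s) = (\<lambda>_. 0)"
    by (simp add: Suc fdiff_def fun_eq_iff)
  then show ?case
    using funpow_fdiff_linear_mult[of "Suc n" "a n" "b n" "\<lambda>i. \<Prod>s<n. a s + of_nat i * b s"]
    by (simp add: Suc fun_eq_iff mult_ac del: funpow.simps)
qed simp

text \<open>Reflection swaps the two values in a difference, so every level contributes a sign. The
  bound on \<open>i + n\<close> keeps the natural subtractions from truncating.\<close>

lemma funpow_fdiff_reverse:
  "i + n \<le> M \<Longrightarrow> (fdiff ^^ n) (\<lambda>i. f (M - i)) i = (-1) ^ n * (fdiff ^^ n) f (M - n - i)"
proof (induction n arbitrary: i)
  case (Suc n)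
  have "M - n - i = Suc (M - Suc n - i)" "M - n - Suc i = M - Suc n - i"
    using Suc.prems by auto
  then show ?case
    using Suc.IH[of i] Suc.IH[of "Suc i"] Suc.prems by (simp add: fdiff_def algebra_simps)
qed simp

text \<open>An n-th difference at \<open>i\<close> sees only the values at \<open>i\<close>, ...,
  \<open>i + n\<close>. This window matters because the symmetry of the colors is known only for
  indices below \<open>k\<close>.\<close>

lemma funpow_fdiff_cong_mod:
  fixes f g :: "nat \<Rightarrow> int"
  assumes "\<And>j. i \<le> j \<Longrightarrow> j \<le> i + n \<Longrightarrow> [f j = g j] (mod m)"
  shows "[(fdiff ^^ n) f i = (fdiff ^^ n) g i] (mod m)"
  using assms
proof (induction n arbitrary: i)
  case (Suc n)
  show ?case
    using Suc.IH[of i] Suc.IH[of "Suc i"] Suc.prems by (auto simp: fdiff_def intro!: cong_diff)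
qed simp

lemma of_int_funpow_fdiff:
  "of_int ((fdiff ^^ n) f i) = (fdiff ^^ n) (\<lambda>i. of_int (f i)) i"
  by (induction n arbitrary: i) (auto simp: fdiff_def)

section \<open>Congruences modulo an ideal\<close>

text \<open>Finite fields appear below as \<open>int poly\<close> modulo an ideal. Computations use
  representatives, with \<open>eqv\<close> in the role of equality in the quotient, so no type
  depending on \<open>p\<close> and \<open>r\<close> is formed.\<close>

locale ring_ideal =
  fixes I :: "'a::comm_ring_1 set"
  assumes zero_mem: "0 \<in> I"
    and add_mem: "a \<in> I \<Longrightarrow> b \<in> I \<Longrightarrow> a + b \<in> I"
    and mult_mem: "a \<in> I \<Longrightarrow> c * a \<in> I"
begin

lemma mult_mem': "a \<in> I \<Longrightarrow> a * c \<in> I"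
  using mult_mem[of a c] by (simp add: mult.commute)

lemma minus_mem: "a \<in> I \<Longrightarrow> - a \<in> I"
  using mult_mem[of a "-1"] by simp

lemma diff_mem: "a \<in> I \<Longrightarrow> b \<in> I \<Longrightarrow> a - b \<in> I"
  using add_mem[of a "-b"] minus_mem by simp

lemma sum_mem: "(\<And>x. x \<in> A \<Longrightarrow> f x \<in> I) \<Longrightarrow> sum f A \<in> I"
  by (induction A rule: infinite_finite_induct) (auto simp: zero_mem add_mem)

definition eqv :: "'a \<Rightarrow> 'a \<Rightarrow> bool" (infix "\<approx>" 50) where
  "a \<approx> b \<longleftrightarrow> a - b \<in> I"

lemma eqv_refl [simp]: "a \<approx> a"
  by (simp add: eqv_def zero_mem)

lemma eqv_0_iff: "a \<approx> 0 \<longleftrightarrow> a \<in> I"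
  by (simp add: eqv_def)

lemma eqv_sym: "a \<approx> b \<Longrightarrow> b \<approx> a"
  using minus_mem by (fastforce simp: eqv_def)

lemma eqv_trans [trans]: "a \<approx> b \<Longrightarrow> b \<approx> c \<Longrightarrow> a \<approx> c"
  using add_mem[of "a - b" "b - c"] by (simp add: eqv_def)

lemma eqv_mem: "a \<approx> b \<Longrightarrow> a \<in> I \<longleftrightarrow> b \<in> I"
  using eqv_trans eqv_sym eqv_0_iff by metis

lemma eqv_add: "a \<approx> b \<Longrightarrow> c \<approx> d \<Longrightarrow> a + c \<approx> b + d"
  using add_mem[of "a - b" "c - d"] by (simp add: eqv_def algebra_simps)

lemma eqv_diff: "a \<approx> b \<Longrightarrow> c \<approx> d \<Longrightarrow> a - c \<approx> b - d"
  using diff_mem[of "a - b" "c - d"] by (simp add: eqv_def algebra_simps)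

lemma eqv_mult: "a \<approx> b \<Longrightarrow> c \<approx> d \<Longrightarrow> a * c \<approx> b * d"
  using add_mem[OF mult_mem[of "a - b" c] mult_mem[of "c - d" b]]
  by (simp add: eqv_def algebra_simps)

lemma eqv_power: "a \<approx> b \<Longrightarrow> a ^ n \<approx> b ^ n"
  by (induction n) (auto intro: eqv_mult)

lemma eqv_prod: "(\<And>x. x \<in> A \<Longrightarrow> f x \<approx> g x) \<Longrightarrow> prod f A \<approx> prod g A"
  by (induction A rule: infinite_finite_induct) (auto intro: eqv_mult)

lemma eqv_poly: "a \<approx> b \<Longrightarrow> poly f a \<approx> poly f b"
  by (induction f) (auto intro: eqv_add eqv_mult)

lemma eqv_funpow_fdiff: "(\<And>i. f i \<approx> g i) \<Longrightarrow> (fdiff ^^ n) f i \<approx> (fdiff ^^ n) g i"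
  by (induction n arbitrary: i) (auto simp: fdiff_def intro: eqv_diff)

end

section \<open>The Frobenius map modulo an ideal containing p\<close>

locale ring_ideal_char = ring_ideal I for I :: "'a::comm_ring_1 set" +
  fixes p :: nat
  assumes prime_p: "prime p" and p_mem: "of_nat p \<in> I"
begin

lemma of_nat_mem: "p dvd n \<Longrightarrow> of_nat n \<in> I"
  using mult_mem'[OF p_mem] by (auto elim!: dvdE)

lemma of_int_mem: "int p dvd n \<Longrightarrow> of_int n \<in> I"
  using mult_mem'[OF p_mem] by (auto elim!: dvdE)

lemma of_int_eqv: "[a = b] (mod int p) \<Longrightarrow> of_int a \<approx> of_int b"
  using of_int_mem[of "a - b"] by (simp add: eqv_def cong_iff_dvd_diff)

text \<open>All binomial coefficients except the outer two are divisible by \<open>p\<close> and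
  hence vanish modulo \<open>I\<close>.\<close>

lemma frobenius_add: "(a + b) ^ p \<approx> a ^ p + b ^ p"
proof -
  have p: "p > 0" using prime_p by (simp add: prime_gt_0_nat)
  let ?t = "\<lambda>k. of_nat (p choose k) * a ^ k * b ^ (p - k)"
  have "{..p} = insert 0 (insert p {1..<p})" by auto
  then have "(a + b) ^ p = b ^ p + (a ^ p + (\<Sum>k\<in>{1..<p}. ?t k))"
    using p by (simp add: binomial_ring)
  moreover have "(\<Sum>k\<in>{1..<p}. ?t k) \<in> I"
  proof (rule sum_mem)
    fix k assume "k \<in> {1..<p}"
    then have "p dvd (p choose k)"
      using prime_p by (intro dvd_choose_prime) auto
    then show "?t k \<in> I" by (intro mult_mem' of_nat_mem)
  qed
  ultimately show ?thesis by (simp add: eqv_def)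
qed

lemma frobenius_iter_add: "(a + b) ^ (p ^ s) \<approx> a ^ (p ^ s) + b ^ (p ^ s)"
proof (induction s)
  case (Suc s)
  have "(a + b) ^ (p ^ Suc s) = ((a + b) ^ (p ^ s)) ^ p"
    by (simp add: mult.commute flip: power_mult)
  also have "\<dots> \<approx> (a ^ (p ^ s) + b ^ (p ^ s)) ^ p"
    by (rule eqv_power) (rule Suc)
  also have "\<dots> \<approx> (a ^ (p ^ s)) ^ p + (b ^ (p ^ s)) ^ p"
    by (rule frobenius_add)
  also have "\<dots> = a ^ (p ^ Suc s) + b ^ (p ^ Suc s)"
    by (simp add: mult.commute flip: power_mult)
  finally show ?case .
qed simp

text \<open>Fermat's little theorem, from additivity of the Frobenius map applied to
  \<open>1 + n\<close>.\<close>

lemma frobenius_of_nat: "of_nat n ^ (p ^ s) \<approx> of_nat n"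
proof (induction n)
  case 0
  then show ?case using prime_gt_0_nat[OF prime_p] by (simp add: power_0_left)
next
  case (Suc n)
  have "(1 + of_nat n) ^ (p ^ s) \<approx> 1 ^ (p ^ s) + of_nat n ^ (p ^ s)"
    by (rule frobenius_iter_add)
  also have "\<dots> \<approx> 1 + of_nat n" using eqv_add[OF eqv_refl Suc] by simp
  finally show ?case by simp
qed

lemma frobenius_of_int: "of_int n ^ (p ^ s) \<approx> of_int n"
proof -
  have "p > 0" using prime_p by (simp add: prime_gt_0_nat)
  then have n: "of_int n \<approx> of_nat (nat (n mod int p))"
    using of_int_eqv[of n "n mod int p"] by (simp add: cong_def)
  then show ?thesis
    using frobenius_of_nat eqv_power eqv_trans eqv_sym by metis
qed

text \<open>The Frobenius map is additive and multiplicative and fixes integer coefficients, so it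
  only acts on the argument.\<close>

lemma frobenius_poly:
  "poly (map_poly of_int g) y ^ (p ^ s) \<approx> poly (map_poly of_int g) (y ^ (p ^ s))"
proof (induction g)
  case 0
  then show ?case using prime_gt_0_nat[OF prime_p] by (simp add: power_0_left)
next
  case (pCons a g)
  have "(of_int a + y * poly (map_poly of_int g) y) ^ (p ^ s)
      \<approx> of_int a ^ (p ^ s) + (y * poly (map_poly of_int g) y) ^ (p ^ s)"
    by (rule frobenius_iter_add)
  also have "\<dots> \<approx> of_int a + y ^ (p ^ s) * poly (map_poly of_int g) (y ^ (p ^ s))"
    unfolding power_mult_distrib
    by (intro eqv_add eqv_mult frobenius_of_int pCons eqv_refl)
  finally show ?case by (simp add: map_poly_pCons)
qed

end

section \<open>Root counting and the prime field modulo a prime ideal\<close>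

locale prime_ring_ideal = ring_ideal I for I :: "'a::comm_ring_1 set" +
  assumes one_not_mem: "1 \<notin> I"
    and prime_mem: "a * b \<in> I \<Longrightarrow> a \<in> I \<or> b \<in> I"
begin

lemma power_mem: "a ^ n \<in> I \<Longrightarrow> a \<in> I"
  by (induction n) (use one_not_mem prime_mem in auto)

text \<open>The quotient is an integral domain, where a nonzero polynomial has at most as many roots
  as its degree. Splitting off the root \<open>x n\<close> by synthetic division needs no inverses,
  and the other roots pass to the quotient polynomial.\<close>

lemma coeffs_mem_if_many_roots:
  assumes "degree f < n" and "\<And>i. i < n \<Longrightarrow> poly f (x i) \<in> I"
    and "\<And>i j. i < j \<Longrightarrow> j < n \<Longrightarrow> \<not> x i \<approx> x j"
  shows "coeff f j \<in> I"
  using assms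
proof (induction n arbitrary: f j)
  case (Suc n)
  define a where "a = x n"
  define h where "h = synthetic_div f a"
  have f: "f = [:- a, 1:] * h + [:poly f a:]"
    by (simp only: h_def synthetic_div_correct')
  have a: "poly f a \<in> I"
    using Suc.prems(2)[of n] by (simp add: a_def)
  have "coeff h j \<in> I" for j
  proof (cases "n = 0")
    case True
    then have "h = 0" using Suc.prems(1) by (simp add: h_def synthetic_div_eq_0_iff)
    then show ?thesis by (simp add: zero_mem)
  next
    case False
    show ?thesis
    proof (rule Suc.IH)
      show "degree h < n" using Suc.prems(1) False by (simp add: h_def degree_synthetic_div)
      show "\<not> x i \<approx> x j" if "i < j" "j < n" for i j
        using Suc.prems(3)[of i j] that by simp
      fix i assume i: "i < n"
      have "poly f (x i) = poly ([:- a, 1:] * h + [:poly f a:]) (x i)"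
        using f by simp
      then have "(x i - a) * poly h (x i) = poly f (x i) - poly f a"
        by (simp add: algebra_simps)
      moreover have "poly f (x i) - poly f a \<in> I"
        using Suc.prems(2)[of i] i a by (intro diff_mem) auto
      ultimately have "(x i - a) * poly h (x i) \<in> I" by simp
      moreover have "x i - a \<notin> I"
        using Suc.prems(3)[of i n] i by (simp add: eqv_def a_def)
      ultimately show "poly h (x i) \<in> I" using prime_mem by blast
    qed
  qed
  then have "coeff ([:- a, 1:] * h + [:poly f a:]) j \<in> I"
    using a by (cases j) (auto simp: coeff_pCons intro!: add_mem diff_mem mult_mem minus_mem)
  then show ?case by (simp only: f[symmetric])
qed simp

end

locale prime_ring_ideal_char = prime_ring_ideal I + ring_ideal_char I p
  for I :: "'a::comm_ring_1 set" and p
begin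

text \<open>By Bezout, an integer in \<open>I\<close> prime to \<open>p\<close> would put 1 into
  \<open>I\<close>. Hence F_p embeds into the quotient, and congruences modulo \<open>p\<close> can
  be tested there.\<close>

lemma of_int_mem_iff: "of_int n \<in> I \<longleftrightarrow> int p dvd n"
proof
  assume n: "of_int n \<in> I"
  show "int p dvd n"
  proof (rule ccontr)
    assume "\<not> int p dvd n"
    then have "coprime (int p) n"
      using prime_p by (intro prime_imp_coprime) auto
    then obtain u v where "u * int p + v * n = 1"
      using bezout_int[of "int p" n] by auto
    then have "(of_int (u * int p + v * n) :: 'a) = 1" by simp
    then have "of_int u * of_nat p + of_int v * of_int n = (1 :: 'a)" by simp
    moreover have "of_int u * of_nat p + of_int v * of_int n \<in> I"
      using n p_mem by (intro add_mem mult_mem)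
    ultimately show False using one_not_mem by simp
  qed
qed (rule of_int_mem)

text \<open>Additivity turns the claim into the absence of nilpotents modulo a prime ideal.\<close>

lemma frobenius_inj: "a ^ (p ^ s) \<approx> b ^ (p ^ s) \<Longrightarrow> a \<approx> b"
proof -
  assume "a ^ (p ^ s) \<approx> b ^ (p ^ s)"
  moreover have "a ^ (p ^ s) \<approx> (a - b) ^ (p ^ s) + b ^ (p ^ s)"
    using frobenius_iter_add[of "a - b" b s] by simp
  ultimately have "(a - b) ^ (p ^ s) + b ^ (p ^ s) \<approx> b ^ (p ^ s)"
    using eqv_trans eqv_sym by blast
  then have "(a - b) ^ (p ^ s) \<in> I" by (simp add: eqv_def)
  then show "a \<approx> b" using power_mem by (simp add: eqv_def)
qed

text \<open>The monic polynomial \<open>T ^ p - T\<close> already has the roots 0, ..., p - 1; a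
  fixed point outside the prime field would be one root too many.\<close>

lemma prime_field_fixed_points:
  assumes "y ^ p \<approx> y"
  shows "\<exists>n::int. 0 \<le> n \<and> n < int p \<and> y \<approx> of_int n"
proof (rule ccontr)
  assume *: "\<not> ?thesis"
  have p: "p > 1" using prime_gt_1_nat[OF prime_p] .
  define f :: "'a poly" where "f = monom 1 p - monom 1 1"
  define x where "x = (\<lambda>i. if i < p then of_nat i else y)"
  have "coeff f p \<in> I"
  proof (rule coeffs_mem_if_many_roots)
    show "degree f < Suc p"
      unfolding f_def using p
      by (intro le_imp_less_Suc degree_diff_le) (auto intro: order.trans[OF degree_monom_le])
    show "poly f (x i) \<in> I" if "i < Suc p" for i
      using that assms frobenius_of_nat[of i 1]
      by (auto simp: f_def x_def poly_monom eqv_def)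
    show "\<not> x i \<approx> x j" if ij: "i < j" "j < Suc p" for i j
    proof (cases "j = p")
      case True
      then show ?thesis using * eqv_sym ij by (force simp: x_def dest: spec[of _ "int i"])
    next
      case False
      show ?thesis
      proof
        assume "x i \<approx> x j"
        then have "of_int (int i - int j) \<in> I" using ij False by (simp add: x_def eqv_def)
        then have "int p dvd int i - int j" by (simp only: of_int_mem_iff)
        then show False using ij False zdvd_imp_le[of "int p" "int j - int i"]
          by (simp add: dvd_diff_commute)
      qed
    qed
  qed
  then show False using p one_not_mem by (simp add: f_def)
qed

end

section \<open>Finite fields as residue rings of integer polynomials\<close>

text \<open>Zorn yields an ideal \<open>M\<close> maximal among those containing \<open>J\<close>
  and avoiding \<open>w\<close>. If \<open>a * b\<close> is in \<open>M\<close> but neither factor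
  is, then \<open>w\<close> lies in both M + (a) and M + (b), so \<open>w * w\<close> is in
  \<open>M\<close>; since \<open>w ^ q\<close> and \<open>w\<close> agree modulo \<open>M\<close>,
  so is \<open>w\<close>.\<close>

lemma exists_prime_ring_ideal_avoiding:
  fixes J :: "'a::comm_ring_1 set"
  assumes J: "ring_ideal J" and q: "q \<ge> 2" and pow: "\<And>y. y ^ q - y \<in> J" and w: "w \<notin> J"
  obtains P where "prime_ring_ideal P" "J \<subseteq> P" "w \<notin> P"
proof -
  define A where "A = {K. ring_ideal K \<and> J \<subseteq> K \<and> w \<notin> K}"
  have "\<exists>M\<in>A. \<forall>K\<in>A. M \<subseteq> K \<longrightarrow> K = M"
  proof (rule subset_Zorn_nonempty)
    show "A \<noteq> {}" using J w by (auto simp: A_def)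
    fix C assume C: "C \<noteq> {}" "subset.chain A C"
    then have sub: "C \<subseteq> A" and lin: "\<And>K L. K \<in> C \<Longrightarrow> L \<in> C \<Longrightarrow> K \<subseteq> L \<or> L \<subseteq> K"
      by (auto simp: subset_chain_def)
    obtain K0 where K0: "K0 \<in> C" using C by auto
    have id: "ring_ideal K" if "K \<in> C" for K using that sub by (auto simp: A_def)
    have "ring_ideal (\<Union>C)"
    proof
      show "0 \<in> \<Union>C" using K0 id[OF K0] ring_ideal.zero_mem by auto
    next
      fix a b assume "a \<in> \<Union>C" "b \<in> \<Union>C"
      then obtain K where "K \<in> C" "a \<in> K" "b \<in> K" using lin by blast
      then show "a + b \<in> \<Union>C" using id ring_ideal.add_mem by blast
    next
      fix a c assume "a \<in> \<Union>C"
      then show "c * a \<in> \<Union>C" using id ring_ideal.mult_mem by blast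
    qed
    then show "\<Union>C \<in> A" using K0 sub by (auto simp: A_def)
  qed
  then obtain M where M: "ring_ideal M" "J \<subseteq> M" "w \<notin> M"
    and max: "\<And>K. K \<in> A \<Longrightarrow> M \<subseteq> K \<Longrightarrow> K = M"
    by (auto simp: A_def)
  interpret M: ring_ideal M by fact
  have ext: "\<exists>m\<in>M. \<exists>c. w = m + c * a" if a: "a \<notin> M" for a
  proof (rule ccontr)
    assume no: "\<not> ?thesis"
    define K where "K = {m + c * a | m c. m \<in> M}"
    have "ring_ideal K"
    proof
      show "0 \<in> K" unfolding K_def by (rule CollectI, rule exI[of _ 0], rule exI[of _ 0]) (simp add: M.zero_mem)
    next
      fix x y assume "x \<in> K" "y \<in> K"
      then obtain m c m' c' where "x = m + c * a" "y = m' + c' * a" "m \<in> M" "m' \<in> M"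
        by (auto simp: K_def)
      then have "x + y = (m + m') + (c + c') * a" "m + m' \<in> M"
        by (auto simp: algebra_simps M.add_mem)
      then show "x + y \<in> K" unfolding K_def by blast
    next
      fix x d assume "x \<in> K"
      then obtain m c where "x = m + c * a" "m \<in> M" by (auto simp: K_def)
      then have "d * x = d * m + (d * c) * a" "d * m \<in> M"
        by (auto simp: algebra_simps M.mult_mem)
      then show "d * x \<in> K" unfolding K_def by blast
    qed
    moreover have MK: "M \<subseteq> K"
    proof
      fix m assume "m \<in> M"
      then show "m \<in> K"
        unfolding K_def by (intro CollectI exI[of _ m] exI[of _ 0]) simp
    qed
    moreover have "w \<notin> K" using no by (auto simp: K_def)
    ultimately have "K = M" using M max[of K] by (auto simp: A_def)
    moreover have "a \<in> K"
      unfolding K_def by (intro CollectI exI[of _ 0] exI[of _ 1]) (simp add: M.zero_mem)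
    ultimately show False using a by simp
  qed
  have "prime_ring_ideal M"
  proof
    show "1 \<notin> M" using M.mult_mem[of 1 w] M by auto
    fix a b assume ab: "a * b \<in> M"
    show "a \<in> M \<or> b \<in> M"
    proof (rule ccontr)
      assume "\<not> ?thesis"
      then obtain m c n d where w: "w = m + c * a" "w = n + d * b" and mn: "m \<in> M" "n \<in> M"
        using ext by blast
      have "w * w = m * w + c * a * n + (c * d) * (a * b)"
      proof -
        have "w * w = (m + c * a) * w" by (simp only: w(1)[symmetric])
        also have "\<dots> = m * w + c * a * w" by (rule distrib_right)
        also have "c * a * w = c * a * (n + d * b)" by (simp only: w(2)[symmetric])
        also have "m * w + \<dots> = m * w + c * a * n + (c * d) * (a * b)" by (simp add: algebra_simps)
        finally show ?thesis .
      qed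
      also have "\<dots> \<in> M" by (intro M.add_mem M.mult_mem M.mult_mem' mn ab)
      finally have "w ^ (q - 2) * (w * w) \<in> M" by (rule M.mult_mem)
      moreover have "w ^ (q - 2) * (w * w) = w ^ q"
        using q by (metis le_add_diff_inverse2 power2_eq_square power_add)
      moreover have "w ^ q - w \<in> M" using pow M by auto
      ultimately have "w ^ q - (w ^ q - w) \<in> M" by (metis M.diff_mem)
      then show False using M by simp
    qed
  qed
  then show thesis using that M by blast
qed

text \<open>Every element of Z[X] is thereby an integer polynomial evaluated at X, so
  \<open>frobenius_poly\<close> applies to all of them.\<close>

lemma poly_map_of_int_monom: "poly (map_poly of_int g) (monom 1 1) = (g :: int poly)"
proof (induction g)
  case (pCons a g)
  then show ?case
    by (simp add: map_poly_pCons monom_Suc monom_0 of_int_poly)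
qed simp

lemma sum_powers_less: "p \<ge> 2 \<Longrightarrow> (\<Sum>d\<in>{1..<r}. p ^ d) < p ^ r" for p :: nat
proof (induction r)
  case (Suc r)
  show ?case
  proof (cases "r = 0")
    case False
    have "(\<Sum>d\<in>{1..<Suc r}. p ^ d) < p ^ r + p ^ r"
      using Suc False by simp
    also have "\<dots> \<le> p ^ Suc r"
      using mult_le_mono1[OF Suc.prems, of "p ^ r"] by (simp only: power_Suc mult_2)
    finally show ?thesis .
  qed (use Suc.prems in simp)
qed simp

text \<open>The residue field \<open>\<int>[X]/P\<close> contains a root of \<open>X ^ p ^ r - X\<close> of degree exactly \<open>r\<close>
  over the prime field, namely the class of \<open>X\<close>.\<close>

locale residue_field = prime_ring_ideal_char P p for P :: "int poly set" and p :: nat +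
  fixes r :: nat
  assumes r_pos: "r > 0"
    and frobenius_X: "eqv (monom 1 1 ^ (p ^ r)) (monom 1 1)"
    and frobenius_X_neq: "0 < d \<Longrightarrow> d < r \<Longrightarrow> \<not> eqv (monom 1 1 ^ (p ^ d)) (monom 1 1)"

text \<open>With \<open>q = p ^ r\<close>, every \<open>y\<close> satisfies \<open>y ^ q = y\<close> modulo \<open>J = (p, X ^ q - X)\<close>, and the product
  \<open>w\<close> of all \<open>X ^ p ^ d - X\<close> with \<open>0 < d < r\<close> is monic of degree less than \<open>q\<close>, hence not in \<open>J\<close>.
  So a prime ideal above \<open>J\<close> avoids \<open>w\<close>.\<close>

lemma exists_residue_field:
  assumes p: "prime p" and r: "r > 0"
  obtains P where "residue_field P p r"
proof -
  define q where "q = p ^ r"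
  have p2: "p \<ge> 2" using p by (rule prime_ge_2_nat)
  have q: "q \<ge> 2" using p2 r self_le_power[of p r] by (simp add: q_def)
  define X :: "int poly" where "X = monom 1 1"
  have X_pow: "X ^ n = monom 1 n" for n by (simp add: X_def monom_power)
  define F where "F = X ^ q - X"
  define J where "J = {of_nat p * g + F * h | g h. True}"
  interpret J: ring_ideal J
  proof
    show "0 \<in> J" unfolding J_def by (rule CollectI, rule exI[of _ 0], rule exI[of _ 0]) simp
  next
    fix x y assume "x \<in> J" "y \<in> J"
    then obtain g h g' h' where "x = of_nat p * g + F * h" "y = of_nat p * g' + F * h'"
      by (auto simp: J_def)
    then have "x + y = of_nat p * (g + g') + F * (h + h')" by (simp add: algebra_simps)
    then show "x + y \<in> J" unfolding J_def by blast
  next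
    fix x d assume "x \<in> J"
    then obtain g h where "x = of_nat p * g + F * h" by (auto simp: J_def)
    then have "d * x = of_nat p * (d * g) + F * (d * h)" by (simp add: algebra_simps)
    then show "d * x \<in> J" unfolding J_def by blast
  qed
  have pJ: "of_nat p \<in> J" unfolding J_def
    by (rule CollectI, rule exI[of _ 1], rule exI[of _ 0]) simp
  have FJ: "F \<in> J" unfolding J_def
    by (rule CollectI, rule exI[of _ 0], rule exI[of _ 1]) simp
  interpret J: ring_ideal_char J p
    by unfold_locales (use p pJ in auto)
  \<comment> \<open>The power \<open>q\<close> fixes integer coefficients and replaces X by
    \<open>X ^ q\<close>, which equals X modulo \<open>F\<close>.\<close>
  have pow: "y ^ q - y \<in> J" for y
  proof -
    have "J.eqv (y ^ q) (poly (map_poly of_int y) (X ^ q))"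
      using J.frobenius_poly[of y X r] by (simp only: poly_map_of_int_monom X_def q_def)
    moreover have "J.eqv (X ^ q) X" using FJ by (simp add: J.eqv_def F_def)
    then have "J.eqv (poly (map_poly of_int y) (X ^ q)) (poly (map_poly of_int y) X)"
      by (rule J.eqv_poly)
    ultimately have "J.eqv (y ^ q) (poly (map_poly of_int y) X)" by (rule J.eqv_trans)
    then show ?thesis by (simp only: J.eqv_def poly_map_of_int_monom X_def)
  qed
  define w where "w = (\<Prod>d\<in>{1..<r}. X ^ (p ^ d) - X)"
  have deg: "degree (X ^ n - X) = n" and lead: "lead_coeff (X ^ n - X) = 1" if n: "n \<ge> 2" for n
  proof -
    show d: "degree (X ^ n - X) = n"
    proof (rule antisym)
      show "degree (X ^ n - X) \<le> n"
        unfolding X_pow using n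
        by (intro degree_diff_le) (auto simp: X_def intro: order.trans[OF degree_monom_le])
      show "n \<le> degree (X ^ n - X)"
        unfolding X_pow using n by (intro le_degree) (simp add: X_def)
    qed
    show "lead_coeff (X ^ n - X) = 1"
      unfolding d unfolding X_pow using n by (simp add: X_def)
  qed
  have pd: "p ^ d \<ge> 2" if "d \<in> {1..<r}" for d
    using that p2 self_le_power[of p d] by simp
  have nz: "X ^ (p ^ d) - X \<noteq> 0" if "d \<in> {1..<r}" for d
    using lead[OF pd[OF that]] by auto
  have "degree w = (\<Sum>d\<in>{1..<r}. p ^ d)"
    unfolding w_def using nz deg pd by (subst degree_prod_eq_sum_degree) auto
  then have degw: "degree w < q" using sum_powers_less[OF p2] by (simp add: q_def)
  have leadw: "lead_coeff w = 1"
    unfolding w_def lead_coeff_prod using lead pd by (intro prod.neutral) auto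
  have wJ: "w \<notin> J"
  proof
    assume "w \<in> J"
    then obtain g h where w: "w = of_nat p * g + F * h" by (auto simp: J_def)
    have w_coeff: "coeff w n = int p * coeff g n
        + ((if n < q then 0 else coeff h (n - q)) - (if n < 1 then 0 else coeff h (n - 1)))" for n
      unfolding w F_def X_pow left_diff_distrib coeff_add coeff_diff
      by (simp add: of_nat_poly X_def coeff_monom_mult)
    \<comment> \<open>Degrees from \<open>q\<close> on exceed the degree of \<open>w\<close>, so
      modulo \<open>p\<close> the coefficients of \<open>h\<close> have period \<open>q - 1\<close>.
      They eventually vanish, so \<open>p\<close> divides all of them, and then also the leading
      coefficient 1 of \<open>w\<close>.\<close>
    have step: "int p dvd coeff h m - coeff h (m + (q - 1))" for m
    proof -
      have "coeff w (m + q) = 0" using degw by (intro coeff_eq_0) simp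
      then have "coeff h m - coeff h (m + (q - 1)) = int p * (- coeff g (m + q))"
        using w_coeff[of "m + q"] q by simp
      then show ?thesis by (metis dvd_triv_left)
    qed
    have iter: "int p dvd coeff h m - coeff h (m + t * (q - 1))" for m t
    proof (induction t)
      case (Suc t)
      have "m + Suc t * (q - 1) = m + t * (q - 1) + (q - 1)" by simp
      then show ?case
        using dvd_add[OF Suc step[of "m + t * (q - 1)"]] by (simp only: diff_add_cancel add_diff_eq)
    qed simp
    have h: "int p dvd coeff h m" for m
    proof -
      have "degree h < m + Suc (degree h) * (q - 1)"
        using q by (cases "q - 1") auto
      then have "coeff h (m + Suc (degree h) * (q - 1)) = 0" by (rule coeff_eq_0)
      then show ?thesis using iter[of m "Suc (degree h)"] by simp
    qed
    have "int p dvd coeff w (degree w)"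
      unfolding w_coeff using h by (intro dvd_add dvd_diff) auto
    then show False using leadw p2 by simp
  qed
  obtain P where P: "prime_ring_ideal P" "J \<subseteq> P" "w \<notin> P"
    using exists_prime_ring_ideal_avoiding[OF J.ring_ideal_axioms q pow wJ] .
  interpret P: prime_ring_ideal P by fact
  have "residue_field P p r"
  proof
    show "prime p" "0 < r" by fact+
    show "of_nat p \<in> P" using pJ P by auto
    show "P.eqv (monom 1 1 ^ p ^ r) (monom 1 1)"
      using FJ P by (auto simp: P.eqv_def F_def X_def q_def)
    fix d assume "0 < d" "d < r"
    then have "X ^ (p ^ d) - X dvd w" unfolding w_def by (intro dvd_prodI) auto
    then show "\<not> P.eqv (monom 1 1 ^ p ^ d) (monom 1 1)"
      using P(3) P.mult_mem' by (auto simp: P.eqv_def X_def elim!: dvdE)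
  qed
  then show thesis by (rule that)
qed

section \<open>Conjugates and norm forms\<close>

context residue_field
begin

notation eqv (infix "\<approx>" 50)

text \<open>Cancelling the injective power map \<open>p ^ i\<close> would leave X fixed by the power
  \<open>p ^ (j - i)\<close>, where 0 < j - i < r.\<close>

lemma frobenius_X_inj:
  assumes "i < j" "j < r"
  shows "\<not> monom 1 1 ^ (p ^ i) \<approx> monom 1 1 ^ (p ^ j)"
proof
  assume *: "monom 1 1 ^ (p ^ i) \<approx> monom 1 1 ^ (p ^ j)"
  have "(monom 1 1 :: int poly) ^ (p ^ j) = (monom 1 1 ^ (p ^ (j - i))) ^ (p ^ i)"
    using assms by (simp flip: power_mult power_add)
  then have "monom 1 1 \<approx> monom 1 1 ^ (p ^ (j - i))"
    using * frobenius_inj by metis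
  then show False using frobenius_X_neq[of "j - i"] assms eqv_sym by (meson diff_le_self le_less_trans zero_less_diff)
qed

text \<open>The \<open>r\<close> conjugates \<open>X ^ p ^ i\<close> are distinct roots of \<open>g\<close>, viewed over the residue field.\<close>

lemma coeffs_dvd_if_small_degree:
  assumes g: "g \<in> P" and deg: "degree g < r"
  shows "int p dvd coeff g j"
proof -
  have "coeff (map_poly of_int g :: int poly poly) j \<in> P"
  proof (rule coeffs_mem_if_many_roots)
    show "degree (map_poly of_int g :: int poly poly) < r"
      using deg by (simp add: degree_map_poly)
    show "\<not> monom 1 1 ^ (p ^ i) \<approx> monom 1 1 ^ (p ^ j)" if "i < j" "j < r" for i j
      using that by (rule frobenius_X_inj)
    fix i
    have "g ^ (p ^ i) \<approx> poly (map_poly of_int g) (monom 1 1 ^ (p ^ i))"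
      using frobenius_poly[of g "monom 1 1" i] by (simp only: poly_map_of_int_monom)
    moreover have "g ^ (p ^ i) \<in> P"
      using mult_mem'[OF g, of "g ^ (p ^ i - 1)"] prime_gt_0_nat[OF prime_p]
      by (simp flip: power_Suc)
    ultimately show "poly (map_poly of_int g) (monom 1 1 ^ (p ^ i)) \<in> P"
      using eqv_mem by blast
  qed
  then show ?thesis by (simp add: coeff_map_poly of_int_mem_iff)
qed

text \<open>The norm from F_{p^r} to F_p as the product of all conjugates, represented by an integer
  of which only the residue modulo \<open>p\<close> is determined.\<close>

definition norm_rep :: "int poly \<Rightarrow> int" where
  "norm_rep x = (SOME n. (\<Prod>s<r. x ^ (p ^ s)) \<approx> of_int n)"

lemma frobenius_r: "x ^ (p ^ r) \<approx> x"
proof -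
  have "x ^ (p ^ r) \<approx> poly (map_poly of_int x) (monom 1 1 ^ (p ^ r))"
    using frobenius_poly[of x "monom 1 1" r] by (simp only: poly_map_of_int_monom)
  also have "\<dots> \<approx> poly (map_poly of_int x) (monom 1 1)"
    by (rule eqv_poly) (rule frobenius_X)
  finally show ?thesis by (simp only: poly_map_of_int_monom)
qed

text \<open>The p-th power permutes the factors cyclically, as \<open>x ^ (p ^ r)\<close> is again
  \<open>x\<close>. So the product is a Frobenius fixed point and lies in the prime field.\<close>

lemma norm_rep: "(\<Prod>s<r. x ^ (p ^ s)) \<approx> of_int (norm_rep x)"
proof -
  obtain r' where r': "r = Suc r'" using r_pos by (cases r) auto
  have "(\<Prod>s<r. x ^ (p ^ s)) ^ p = (\<Prod>s<r. x ^ (p ^ Suc s))"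
    unfolding prod_power_distrib by (simp add: mult.commute flip: power_mult)
  also have "\<dots> = (\<Prod>s<r'. x ^ (p ^ Suc s)) * x ^ (p ^ r)"
    by (simp add: r')
  also have "\<dots> \<approx> (\<Prod>s<r'. x ^ (p ^ Suc s)) * x"
    by (intro eqv_mult eqv_refl frobenius_r)
  also have "\<dots> = (\<Prod>s<r. x ^ (p ^ s))"
    unfolding r' prod.lessThan_Suc_shift by (simp add: mult.commute)
  finally have "\<exists>n. (\<Prod>s<r. x ^ (p ^ s)) \<approx> of_int n"
    using prime_field_fixed_points by blast
  then show ?thesis unfolding norm_rep_def by (rule someI_ex)
qed

end

text \<open>\<open>N\<close> is the norm of F_{p^r} in the coordinates 1, X, ..., X^(r-1). On a line
  it is a product of \<open>r\<close> linear factors, so its r-th difference is r! times the norm of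
  the direction. Here r! is invertible because \<open>r < p\<close>, and the norm vanishes only at
  0.\<close>

lemma exists_anisotropic_form:
  assumes p: "prime p" and r: "r > 0" "r < p"
  obtains N :: "(nat \<Rightarrow> int) \<Rightarrow> int" where
    "\<And>u v. (\<And>j. j < r \<Longrightarrow> [u j = v j] (mod int p)) \<Longrightarrow> [N u = N v] (mod int p)"
    "\<And>u v. \<exists>L. (\<forall>i. [(fdiff ^^ r) (\<lambda>i. N (\<lambda>j. u j + int i * v j)) i = L] (mod int p)) \<and>
                (int p dvd L \<longrightarrow> (\<forall>j<r. int p dvd v j))"
proof -
  obtain P where "residue_field P p r" using exists_residue_field[OF p r(1)] .
  then interpret residue_field P p r .
  define vec :: "(nat \<Rightarrow> int) \<Rightarrow> int poly" where "vec u = (\<Sum>j<r. monom (u j) j)" for u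
  define N where "N u = norm_rep (vec u)" for u
  have cong_iff: "[a = b] (mod int p) \<longleftrightarrow> of_int a \<approx> of_int b" for a b
    using of_int_mem_iff[of "a - b"] by (simp add: eqv_def cong_iff_dvd_diff)
  have vec_add: "vec (\<lambda>j. u j + int i * v j) = vec u + of_nat i * vec v" for u v i
    by (simp add: vec_def sum.distrib sum_distrib_left of_nat_poly smult_monom flip: add_monom)
  have coeff_vec: "coeff (vec u) j = (if j < r then u j else 0)" for u j
    by (simp add: vec_def coeff_sum)
  have deg_vec: "degree (vec u) < r" for u
    using r by (intro le_less_trans[OF degree_le[of "r - 1"]]) (auto simp: coeff_vec)
  have "[N u = N v] (mod int p)" if uv: "\<And>j. j < r \<Longrightarrow> [u j = v j] (mod int p)" for u v
  proof -
    have "vec u - vec v = (\<Sum>j<r. of_int (u j - v j) * monom 1 j)"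
      by (simp add: vec_def of_int_poly smult_monom diff_monom flip: of_int_diff sum_subtractf)
    also have "\<dots> \<in> P"
      using uv by (intro sum_mem mult_mem' of_int_mem) (simp add: cong_iff_dvd_diff)
    finally have "vec u \<approx> vec v" by (simp add: eqv_def)
    then have "(\<Prod>s<r. vec u ^ (p ^ s)) \<approx> (\<Prod>s<r. vec v ^ (p ^ s))"
      by (intro eqv_prod eqv_power)
    then show ?thesis
      unfolding cong_iff N_def using norm_rep eqv_trans eqv_sym by meson
  qed
  moreover have "\<exists>L. (\<forall>i. [(fdiff ^^ r) (\<lambda>i. N (\<lambda>j. u j + int i * v j)) i = L] (mod int p)) \<and>
                (int p dvd L \<longrightarrow> (\<forall>j<r. int p dvd v j))" for u v
  proof -
    define \<phi> where "\<phi> = (\<lambda>i. N (\<lambda>j. u j + int i * v j))"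
    have \<phi>: "of_int (\<phi> i) \<approx> (\<Prod>s<r. vec u ^ (p ^ s) + of_nat i * vec v ^ (p ^ s))" for i
    proof -
      have "of_int (\<phi> i) \<approx> (\<Prod>s<r. (vec u + of_nat i * vec v) ^ (p ^ s))"
        unfolding \<phi>_def N_def vec_add by (rule eqv_sym) (rule norm_rep)
      \<comment> \<open>The Frobenius map is additive and fixes \<open>i\<close>, so each conjugate
        is again linear in \<open>i\<close>.\<close>
      also have "\<dots> \<approx> (\<Prod>s<r. vec u ^ (p ^ s) + of_nat i * vec v ^ (p ^ s))"
      proof (rule eqv_prod)
        fix s
        have "(vec u + of_nat i * vec v) ^ (p ^ s) \<approx> vec u ^ (p ^ s) + (of_nat i * vec v) ^ (p ^ s)"
          by (rule frobenius_iter_add)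
        also have "\<dots> \<approx> vec u ^ (p ^ s) + of_nat i * vec v ^ (p ^ s)"
          unfolding power_mult_distrib by (intro eqv_add eqv_mult eqv_refl frobenius_of_nat)
        finally show "(vec u + of_nat i * vec v) ^ (p ^ s) \<approx> vec u ^ (p ^ s) + of_nat i * vec v ^ (p ^ s)" .
      qed
      finally show ?thesis .
    qed
    have diff: "of_int ((fdiff ^^ r) \<phi> i) \<approx> fact r * (\<Prod>s<r. vec v ^ (p ^ s))" for i
    proof -
      have "(fdiff ^^ r) (\<lambda>i. of_int (\<phi> i)) i
          \<approx> (fdiff ^^ r) (\<lambda>i. \<Prod>s<r. vec u ^ (p ^ s) + of_nat i * vec v ^ (p ^ s)) i"
        using \<phi> by (rule eqv_funpow_fdiff)
      then show ?thesis by (simp only: of_int_funpow_fdiff funpow_fdiff_prod_linear)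
    qed
    have "int p dvd v j" if dvd: "int p dvd (fdiff ^^ r) \<phi> 0" and j: "j < r" for j
    proof -
      have "fact r * (\<Prod>s<r. vec v ^ (p ^ s)) \<in> P"
        using diff[of 0] of_int_mem[OF dvd] eqv_mem by blast
      moreover have "\<not> int p dvd int (fact r)"
        using r p by (simp only: int_dvd_int_iff prime_dvd_fact_iff)
      then have "(fact r :: int poly) \<notin> P"
        using of_int_mem_iff[of "int (fact r)"] by simp
      \<comment> \<open>The conjugates are powers of \<open>vec v\<close>, so their product is a
        single power.\<close>
      ultimately have "vec v ^ (\<Sum>s<r. p ^ s) \<in> P"
        using prime_mem by (auto simp: power_sum)
      then have "vec v \<in> P" by (rule power_mem)
      then have "int p dvd coeff (vec v) j" using deg_vec by (rule coeffs_dvd_if_small_degree)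
      then show ?thesis using j by (simp add: coeff_vec)
    qed
    moreover have "[(fdiff ^^ r) \<phi> i = (fdiff ^^ r) \<phi> 0] (mod int p)" for i
      unfolding cong_iff using diff eqv_trans eqv_sym by meson
    ultimately show ?thesis unfolding \<phi>_def by blast
  qed
  ultimately show thesis by (rule that)
qed

section \<open>Progressions in the digits\<close>

text \<open>Cutting [0, M) into \<open>c\<close> equal arcs, \<open>c * y div M\<close> is the
  number of the arc containing \<open>y\<close>.\<close>

lemma arc_index_range:
  fixes y M c :: int
  assumes "0 \<le> y" "y < M" "c > 0"
  shows "0 \<le> c * y div M" "c * y div M < c"
proof -
  have "M > 0" "c * y < c * M" using assms by auto
  then show "0 \<le> c * y div M" using assms by (simp add: pos_imp_zdiv_nonneg_iff)
  have "M * (c * y div M) \<le> c * y"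
    using mult_div_mod_eq[of M "c * y"] pos_mod_sign[OF \<open>M > 0\<close>, of "c * y"] by linarith
  also have "\<dots> < M * c" using \<open>c * y < c * M\<close> by (simp add: mult.commute)
  finally show "c * y div M < c" using \<open>M > 0\<close> by simp
qed

lemma div_add_small:
  fixes a e M :: int
  assumes "0 \<le> e" "e < M"
  shows "a div M \<le> (a + e) div M" "(a + e) div M \<le> a div M + 1"
proof -
  show "a div M \<le> (a + e) div M" using assms by (intro zdiv_mono1) auto
  have "(a + e) div M \<le> (a + M) div M" using assms by (intro zdiv_mono1) auto
  then show "(a + e) div M \<le> a div M + 1" using assms by simp
qed

text \<open>A shift by \<open>e\<close> is shorter than an arc, so the arc number changes by at most
  one, in the direction of \<open>e\<close>.\<close>

lemma div_add_small_cases: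
  fixes c y e M :: int
  assumes "0 \<le> c" "\<bar>c * e\<bar> < M"
  shows "0 \<le> e \<Longrightarrow> c * y div M \<le> c * (y + e) div M \<and> c * (y + e) div M \<le> c * y div M + 1"
    and "e \<le> 0 \<Longrightarrow> c * (y + e) div M \<le> c * y div M \<and> c * y div M \<le> c * (y + e) div M + 1"
proof -
  assume "0 \<le> e"
  then show "c * y div M \<le> c * (y + e) div M \<and> c * (y + e) div M \<le> c * y div M + 1"
    using div_add_small[of "c * e" M "c * y"] assms by (simp add: distrib_left)
next
  assume "e \<le> 0"
  then have "0 \<le> - (c * e)" using assms by (simp add: mult_nonneg_nonpos)
  then show "c * (y + e) div M \<le> c * y div M \<and> c * y div M \<le> c * (y + e) div M + 1"
    using div_add_small[of "- (c * e)" M "c * (y + e)"] assms by (simp add: distrib_left)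
qed

text \<open>Lift the two middle terms to the integers; the step is then shorter than an arc, so each
  further pair outwards lies in the same arc or in the two arcs adjacent to it. These are distinct
  because there are at least three arcs, so the whole progression stays in one arc and does not wrap
  around.\<close>

lemma progression_in_residues:
  fixes h :: nat and M a d :: int and x :: "nat \<Rightarrow> int"
  defines "c \<equiv> 2 * int h - 1"
  assumes h: "h \<ge> 2" and M: "M > 0"
    and range: "\<And>i. i < 2 * h \<Longrightarrow> 0 \<le> x i \<and> x i < M"
    and cong: "\<And>i. i < 2 * h \<Longrightarrow> [x i = a + int i * d] (mod M)"
    and sym: "\<And>i. i < 2 * h \<Longrightarrow> c * x i div M = c * x (2 * h - 1 - i) div M"
  shows "\<exists>A D. \<forall>i<2 * h. x i = A + int i * D"
proof -
  have c: "c \<ge> 3" using h by (simp add: c_def)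
  \<comment> \<open>The lift \<open>y\<close> is the integer progression through the residues at the
    two middle indices, \<open>h - 1\<close> and \<open>h\<close>.\<close>
  define D where "D = x h - x (h - 1)"
  define A where "A = x (h - 1) - int (h - 1) * D"
  define y where "y i = A + int i * D" for i
  define G where "G z = c * z div M" for z
  define g where "g = G (x h)"
  have y_mid: "y (h - 1) = x (h - 1)" "y h = x h"
    using h by (simp_all add: y_def A_def D_def algebra_simps of_nat_diff)
  have "2 * h - 1 - h = h - 1" using h by simp
  then have g': "g = G (x (h - 1))"
    using sym[of h] h by (simp add: g_def G_def)
  \<comment> \<open>The middle terms mirror each other and share an arc, so \<open>c * D\<close> is
    a difference of two remainders modulo \<open>M\<close>.\<close>
  have small: "\<bar>c * D\<bar> < M"
  proof -
    have "c * x h = M * g + c * x h mod M" "c * x (h - 1) = M * g + c * x (h - 1) mod M"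
      using mult_div_mod_eq[of M "c * x h"] mult_div_mod_eq[of M "c * x (h - 1)"]
      unfolding G_def[symmetric] g_def[symmetric] g'[symmetric] by simp_all
    then have "c * D = c * x h mod M - c * x (h - 1) mod M"
      by (simp add: D_def right_diff_distrib)
    moreover have "0 \<le> c * x h mod M" "c * x h mod M < M"
        "0 \<le> c * x (h - 1) mod M" "c * x (h - 1) mod M < M"
      using M by auto
    ultimately show ?thesis by linarith
  qed
  have y_cong: "\<exists>t. y i = x i + M * t" if i: "i < 2 * h" for i
  proof -
    have "[x h - x (h - 1) = (a + int h * d) - (a + int (h - 1) * d)] (mod M)"
      using h by (intro cong_diff assms(5)) auto
    then have D: "[D = d] (mod M)"
      using h by (simp add: D_def of_nat_diff algebra_simps)
    have "[x (h - 1) - int (h - 1) * D + int i * D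
        = (a + int (h - 1) * d) - int (h - 1) * d + int i * d] (mod M)"
      using h D by (intro cong_add cong_diff cong_mult assms(5)) auto
    then have "[y i = a + int i * d] (mod M)" by (simp add: y_def A_def)
    then have "[y i = x i] (mod M)" using assms(5)[OF i] cong_sym cong_trans by blast
    then obtain t where "y i - x i = M * t"
      by (auto simp: cong_iff_dvd_diff elim!: dvdE)
    then have "y i = x i + M * t" by simp
    then show ?thesis ..
  qed
  \<comment> \<open>On lifts, one full turn around the circle raises the arc number by
    \<open>c\<close>.\<close>
  have G_shift: "G (z + M * t) = G z + c * t" for z t
  proof -
    have "c * (z + M * t) = c * z + M * (c * t)" by (simp add: algebra_simps)
    then show ?thesis unfolding G_def using M by simp
  qed
  have main: "G (y (h - 1 - j)) = g \<and> G (y (h + j)) = g" if "j < h" for j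
    using that
  proof (induction j)
    case 0
    then show ?case using y_mid g' by (simp add: g_def)
  next
    case (Suc j)
    define u v where "u = G (y (h + Suc j))" and "v = G (y (h - 1 - Suc j))"
    have IH: "G (y (h - 1 - j)) = g" "G (y (h + j)) = g" using Suc by auto
    have y_u: "y (h + Suc j) = y (h + j) + D" by (simp add: y_def algebra_simps)
    have "h - 1 - j = Suc (h - 1 - Suc j)" using Suc.prems by simp
    then have y_v: "y (h - 1 - j) = y (h - 1 - Suc j) + D"
      by (simp only: y_def) (simp add: algebra_simps)
    have "h + Suc j < 2 * h" "h - 1 - Suc j < 2 * h" using Suc.prems by auto
    then obtain t t' where t: "y (h + Suc j) = x (h + Suc j) + M * t"
        "y (h - 1 - Suc j) = x (h - 1 - Suc j) + M * t'"
      using y_cong by metis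
    have "2 * h - 1 - (h + Suc j) = h - 1 - Suc j" by simp
    then have "G (x (h + Suc j)) = G (x (h - 1 - Suc j))"
      using sym[of "h + Suc j"] Suc.prems by (simp add: G_def)
    then have uv: "u - v = c * (t - t')"
      unfolding u_def v_def t G_shift by (simp add: right_diff_distrib)
    have "0 \<le> D \<Longrightarrow> g \<le> u \<and> u \<le> g + 1" "D \<le> 0 \<Longrightarrow> u \<le> g \<and> g \<le> u + 1"
      using div_add_small_cases[OF _ small, of "y (h + j)"] c
      unfolding u_def y_u IH(2)[symmetric] G_def by simp_all
    moreover have "0 \<le> D \<Longrightarrow> v \<le> g \<and> g \<le> v + 1" "D \<le> 0 \<Longrightarrow> g \<le> v \<and> v \<le> g + 1"
      using div_add_small_cases[OF _ small, of "y (h - 1 - Suc j)"] c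
      unfolding v_def IH(1)[symmetric] y_v G_def by simp_all
    \<comment> \<open>The two outward moves go in opposite directions, so \<open>u\<close> and
      \<open>v\<close> differ by at most 2, less than \<open>c\<close>; the difference is a multiple
      of \<open>c\<close>, hence 0.\<close>
    ultimately have "(g \<le> u \<and> u \<le> g + 1 \<and> v \<le> g \<and> g \<le> v + 1) \<or>
        (u \<le> g \<and> g \<le> u + 1 \<and> g \<le> v \<and> v \<le> g + 1)"
      by linarith
    then have "u - v = 0 \<Longrightarrow> u = g \<and> v = g" and "\<bar>u - v\<bar> < c" using c by auto
    moreover have "u - v = 0"
      using uv \<open>\<bar>u - v\<bar> < c\<close> dvd_imp_le_int[of "u - v" c] by force
    ultimately show ?case by (simp add: u_def v_def)
  qed
  have "x i = y i" if i: "i < 2 * h" for i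
  proof -
    have "G (y i) = g"
    proof (cases "i < h")
      case True
      then show ?thesis using main[of "h - 1 - i"] by simp
    next
      case False
      then show ?thesis using main[of "i - h"] i by simp
    qed
    moreover have "0 \<le> g" "g < c"
      using arc_index_range[of "x h" M c] range[of h] h c by (auto simp: g_def G_def)
    ultimately have G: "0 \<le> G (y i)" "G (y i) < c" by auto
    obtain t where t: "y i = x i + M * t" using y_cong[OF i] by blast
    have "0 \<le> G (x i)" "G (x i) < c"
      using arc_index_range[of "x i" M c] range[OF i] c by (auto simp: G_def)
    moreover have "G (y i) = G (x i) + c * t" unfolding t G_shift ..
    \<comment> \<open>Two arc numbers in the range from 0 to \<open>c - 1\<close> differ by
      \<open>c * t\<close>, which forces \<open>t = 0\<close>: the lift is the residue
      itself.\<close>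
    ultimately have "c * t < c * 1" "c * (-1) < c * t" using G by linarith+
    then have "t < 1" "-1 < t" using c by (simp_all only: mult_less_cancel_left_pos)
    then show ?thesis using t by simp
  qed
  then show ?thesis unfolding y_def by blast
qed

text \<open>The digit at \<open>s\<close> is what remains of \<open>x i\<close> after subtracting
  its residue modulo \<open>p ^ s\<close> and dividing by \<open>p ^ s\<close>; both terms are
  progressions, hence so is the digit modulo \<open>p\<close>. If all digit steps vanish,
  divisibility of \<open>d\<close> climbs one power at a time.\<close>

lemma progression_in_digits:
  fixes p m n :: nat and a d :: int and x A D :: "nat \<Rightarrow> int"
  assumes p: "p > 1" and n: "n \<ge> 2"
    and x: "\<And>i. i < n \<Longrightarrow> [x i = a + int i * d] (mod int p ^ m)"
    and res: "\<And>i s. i < n \<Longrightarrow> s < m \<Longrightarrow> x i mod int p ^ s = A s + int i * D s"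
  obtains \<alpha> \<delta> where
    "\<And>i s. i < n \<Longrightarrow> s < m \<Longrightarrow> [x i div int p ^ s = \<alpha> s + int i * \<delta> s] (mod int p)"
    "(\<And>s. s < m \<Longrightarrow> int p dvd \<delta> s) \<Longrightarrow> int p ^ m dvd d"
proof -
  \<comment> \<open>These divisions are exact for \<open>s < m\<close>: comparing indices 0 and 1
    shows that \<open>A s\<close> and \<open>D s\<close> agree with \<open>a\<close> and
    \<open>d\<close> modulo \<open>p ^ s\<close>.\<close>
  define \<alpha> \<delta> where "\<alpha> s = (a - A s) div int p ^ s" and "\<delta> s = (d - D s) div int p ^ s" for s
  have \<alpha>: "a = A s + int p ^ s * \<alpha> s" and \<delta>: "d = D s + int p ^ s * \<delta> s" if s: "s < m" for s
  proof -
    have x': "[A s + int i * D s = a + int i * d] (mod int p ^ s)" if i: "i < n" for i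
    proof -
      have "[x i = a + int i * d] (mod int p ^ s)"
        using x[OF i] by (rule cong_dvd_modulus) (use s in \<open>auto intro: le_imp_power_dvd\<close>)
      then show ?thesis using res[OF i s] by (metis cong_mod_left)
    qed
    have a: "[A s = a] (mod int p ^ s)" using x'[of 0] n by simp
    have "[(A s + D s) - A s = (a + d) - a] (mod int p ^ s)"
      by (intro cong_diff a) (use x'[of 1] n in simp)
    then have d: "[D s = d] (mod int p ^ s)" by simp
    show "a = A s + int p ^ s * \<alpha> s" "d = D s + int p ^ s * \<delta> s"
      using a d by (simp_all add: \<alpha>_def \<delta>_def cong_iff_dvd_diff dvd_diff_commute)
  qed
  have "[x i div int p ^ s = \<alpha> s + int i * \<delta> s] (mod int p)" if i: "i < n" and s: "s < m" for i s
  proof -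
    have "x i = int p ^ s * (x i div int p ^ s) + (A s + int i * D s)"
      using res[OF i s] by (metis mult_div_mod_eq)
    then have "x i - (a + int i * d) = int p ^ s * (x i div int p ^ s - (\<alpha> s + int i * \<delta> s))"
      by (subst \<alpha>[OF s], subst \<delta>[OF s]) (simp add: algebra_simps)
    moreover have "int p ^ Suc s dvd x i - (a + int i * d)"
      using x[OF i] le_imp_power_dvd[of "Suc s" m "int p"] s
      by (auto simp: cong_iff_dvd_diff intro: dvd_trans)
    ultimately show ?thesis using p by (simp add: cong_iff_dvd_diff)
  qed
  moreover have "int p ^ m dvd d" if *: "\<And>s. s < m \<Longrightarrow> int p dvd \<delta> s"
  proof -
    have "int p ^ s dvd d" if "s \<le> m" for s
      using that
    proof (induction s)
      case (Suc s)
      then have s: "s < m" and dvd: "int p ^ s dvd d" by auto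
      have "int p ^ s dvd D s"
        using dvd \<delta>[OF s] by (metis dvd_add_left_iff dvd_triv_left)
      \<comment> \<open>Two residues in [0, p^s) differ by \<open>D s\<close>, a multiple of
        \<open>p ^ s\<close>; so there is no residual step.\<close>
      moreover have "0 \<le> A s" "A s < int p ^ s" "0 \<le> A s + D s" "A s + D s < int p ^ s"
        using res[of 0 s] res[of 1 s] n s p pos_mod_bound[of "int p ^ s" "x 0"]
          pos_mod_bound[of "int p ^ s" "x 1"] pos_mod_sign[of "int p ^ s" "x 0"]
          pos_mod_sign[of "int p ^ s" "x 1"] by auto
      then have "\<bar>D s\<bar> < int p ^ s" by linarith
      ultimately have "D s = 0"
        using dvd_imp_le_int[of "D s" "int p ^ s"] by force
      then have "d = int p ^ s * \<delta> s" using \<delta>[OF s] by simp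
      then show ?case using *[OF s] by (simp add: mult.commute)
    qed simp
    then show ?thesis by simp
  qed
  ultimately show thesis by (rule that)
qed

section \<open>Sums of anisotropic forms over digit blocks\<close>

text \<open>Since 1 + 3 + ... + (2l - 1) is l^2, the block of size 2l + 1 starts at position l^2,
  and the first \<open>h\<close> blocks tile the positions below h^2.\<close>

lemma exists_square_block: "s < h\<^sup>2 \<Longrightarrow> \<exists>l<h. \<exists>j<2 * l + 1. s = l\<^sup>2 + j" for s h :: nat
proof (induction h)
  case (Suc h)
  show ?case
  proof (cases "s < h\<^sup>2")
    case True
    then show ?thesis using Suc.IH less_SucI by blast
  next
    case False
    then show ?thesis
      using Suc.prems by (intro exI[of _ h] conjI exI[of _ "s - h\<^sup>2"]) (auto simp: power2_eq_square)
  qed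
qed simp

lemma square_block_less: "l < h \<Longrightarrow> j < 2 * l + 1 \<Longrightarrow> l\<^sup>2 + j < h\<^sup>2" for l h j :: nat
proof -
  assume "l < h" "j < 2 * l + 1"
  then have "(Suc l)\<^sup>2 \<le> h\<^sup>2" by (intro power_mono) auto
  moreover have "l\<^sup>2 + j < (Suc l)\<^sup>2" using \<open>j < 2 * l + 1\<close> by (simp add: power2_eq_square)
  ultimately show ?thesis by (metis less_le_trans)
qed

text \<open>For the largest block \<open>q\<close> with a nonzero step, of size \<open>n\<close>,
  the n-th difference of the sum is a constant \<open>L\<close> not divisible by \<open>p\<close>.
  Reflection with odd \<open>n\<close> gives L = -L modulo \<open>p\<close>, impossible as
  \<open>p\<close> is odd.\<close>

lemma no_symmetric_anisotropic_sum:
  fixes p h :: nat and N :: "nat \<Rightarrow> (nat \<Rightarrow> int) \<Rightarrow> int" and \<alpha> \<delta> :: "nat \<Rightarrow> nat \<Rightarrow> int"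
  assumes p: "odd p" "prime p"
    and N_cong: "\<And>l u v. l < h \<Longrightarrow> (\<And>j. j < 2 * l + 1 \<Longrightarrow> [u j = v j] (mod int p)) \<Longrightarrow>
          [N l u = N l v] (mod int p)"
    and N_diff: "\<And>l u v. l < h \<Longrightarrow>
          \<exists>L. (\<forall>i. [(fdiff ^^ (2 * l + 1)) (\<lambda>i. N l (\<lambda>j. u j + int i * v j)) i = L] (mod int p)) \<and>
            (int p dvd L \<longrightarrow> (\<forall>j<2 * l + 1. int p dvd v j))"
    and sym: "\<And>i. i < 2 * h \<Longrightarrow>
          [(\<Sum>l<h. N l (\<lambda>j. \<alpha> l j + int i * \<delta> l j)) =
           (\<Sum>l<h. N l (\<lambda>j. \<alpha> l j + int (2 * h - 1 - i) * \<delta> l j))] (mod int p)"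
    and l: "l < h" "j < 2 * l + 1"
  shows "int p dvd \<delta> l j"
proof (rule ccontr)
  assume nd: "\<not> int p dvd \<delta> l j"
  define S where "S = {l. l < h \<and> (\<exists>j<2 * l + 1. \<not> int p dvd \<delta> l j)}"
  define q where "q = Max S"
  have fin: "finite S" by (simp add: S_def)
  have "S \<noteq> {}" using nd l by (auto simp: S_def)
  then have "q \<in> S" using fin by (simp add: q_def)
  then have q: "q < h" "\<not> (\<forall>j<2 * q + 1. int p dvd \<delta> q j)" by (auto simp: S_def)
  have above: "int p dvd \<delta> l j" if "q < l" "l < h" "j < 2 * l + 1" for l j
  proof (rule ccontr)
    assume "\<not> int p dvd \<delta> l j"
    then have "l \<in> S" using that by (auto simp: S_def)
    then have "l \<le> q" unfolding q_def by (rule Max_ge[OF fin])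
    then show False using that by simp
  qed
  define n where "n = 2 * q + 1"
  define f where "f l i = N l (\<lambda>j. \<alpha> l j + int i * \<delta> l j)" for l i
  define \<phi> where "\<phi> i = (\<Sum>l<h. f l i)" for i
  obtain L where L: "\<And>i. [(fdiff ^^ n) (f q) i = L] (mod int p)" "\<not> int p dvd L"
    using N_diff[OF q(1), of "\<alpha> q" "\<delta> q"] q(2) unfolding n_def f_def by blast
  have other: "[(fdiff ^^ n) (f l) i = 0] (mod int p)" if lh: "l < h" and lq: "l \<noteq> q" for l i
  proof (cases "l < q")
    case True
    obtain L' where L': "\<And>i. [(fdiff ^^ (2 * l + 1)) (f l) i = L'] (mod int p)"
      using N_diff[OF lh, of "\<alpha> l" "\<delta> l"] unfolding f_def by blast
    \<comment> \<open>A smaller block has a constant difference of order 2l + 1, and at least one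
      further difference kills it.\<close>
    have "n = (n - (2 * l + 1)) + (2 * l + 1)" and pos: "0 < n - (2 * l + 1)"
      using True by (auto simp: n_def)
    then have "(fdiff ^^ n) (f l) = (fdiff ^^ (n - (2 * l + 1))) ((fdiff ^^ (2 * l + 1)) (f l))"
      by (metis comp_apply funpow_add)
    moreover have "[(fdiff ^^ (n - (2 * l + 1))) ((fdiff ^^ (2 * l + 1)) (f l)) i =
        (fdiff ^^ (n - (2 * l + 1))) (\<lambda>_. L') i] (mod int p)"
      by (rule funpow_fdiff_cong_mod) (rule L')
    ultimately show ?thesis using funpow_fdiff_const[OF pos, of L'] by simp
  next
    case False
    \<comment> \<open>Larger blocks have all steps divisible by \<open>p\<close>, so their forms are
      constant modulo \<open>p\<close>.\<close>
    have "[(fdiff ^^ n) (f l) i = (fdiff ^^ n) (\<lambda>_. N l (\<alpha> l)) i] (mod int p)"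
    proof (rule funpow_fdiff_cong_mod)
      fix i
      have "[\<alpha> l j + int i * \<delta> l j = \<alpha> l j] (mod int p)" if "j < 2 * l + 1" for j
        using above[of l j] that False lh lq by (simp add: cong_iff_dvd_diff)
      then show "[f l i = N l (\<alpha> l)] (mod int p)"
        unfolding f_def by (rule N_cong[OF lh])
    qed
    then show ?thesis using funpow_fdiff_const[of n "N l (\<alpha> l)"] by (simp add: n_def del: funpow.simps)
  qed
  have \<phi>: "[(fdiff ^^ n) \<phi> i = L] (mod int p)" for i
  proof -
    have "(fdiff ^^ n) \<phi> i = (\<Sum>l<h. (fdiff ^^ n) (f l) i)"
      using funpow_fdiff_sum[of n f "{..<h}"] by (simp add: \<phi>_def[abs_def])
    also have "[\<dots> = (\<Sum>l<h. if l = q then L else 0)] (mod int p)"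
      by (rule cong_sum) (use L other in auto)
    also have "(\<Sum>l<h. if l = q then L else 0) = L" using q by simp
    finally show ?thesis .
  qed
  have "[(fdiff ^^ n) \<phi> 0 = (fdiff ^^ n) (\<lambda>i. \<phi> (2 * h - 1 - i)) 0] (mod int p)"
  proof (rule funpow_fdiff_cong_mod)
    fix i assume "i \<le> 0 + n"
    \<comment> \<open>The window 0, ..., n fits into the progression because n = 2q + 1 is at most
      2h - 1.\<close>
    then have "i < 2 * h" using q by (simp add: n_def)
    then show "[\<phi> i = \<phi> (2 * h - 1 - i)] (mod int p)"
      unfolding \<phi>_def f_def by (rule sym)
  qed
  also have "(fdiff ^^ n) (\<lambda>i. \<phi> (2 * h - 1 - i)) 0 = - (fdiff ^^ n) \<phi> (2 * h - 1 - n)"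
    using funpow_fdiff_reverse[of 0 n "2 * h - 1" \<phi>] q by (simp add: n_def del: funpow.simps)
  also have "[\<dots> = - L] (mod int p)" using \<phi> by (simp add: cong_minus_minus_iff)
  finally have "[L = - L] (mod int p)" using \<phi>[of 0] cong_sym cong_trans by blast
  then have "int p dvd 2 * L" by (simp add: cong_iff_dvd_diff)
  moreover have "\<not> int p dvd 2"
    using p zdvd_imp_le[of "int p" 2] prime_ge_2_nat[of p] by force
  ultimately show False using L(2) p(2) by (simp add: prime_dvd_mult_iff)
qed

section \<open>The coloring and its verification\<close>

theorem theorem1p1:
  fixes k p :: nat
  assumes "even k" and "k \<ge> 4" and "prime p" and "p > k"
  shows "\<exists>c :: int \<Rightarrow> nat.
           is_coloring ((k - 1) ^ (k\<^sup>2 div 4 - 1) * p)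
             (carrier (integer_mod_group (p ^ (k\<^sup>2 div 4)))) c \<and>
           \<not> has_nontrivial_symmetrically_colored_AP (integer_mod_group (p ^ (k\<^sup>2 div 4))) c k"
proof -
  obtain h where k: "k = 2 * h" using \<open>even k\<close> by (elim evenE)
  have h: "h \<ge> 2" using \<open>k \<ge> 4\<close> k by simp
  define m where "m = h\<^sup>2"
  have m: "k\<^sup>2 div 4 = m" by (simp add: k m_def power_mult_distrib)
  have p1: "p > 1" using \<open>prime p\<close> by (rule prime_gt_1_nat)
  have "odd p" using \<open>prime p\<close> \<open>p > k\<close> \<open>k \<ge> 4\<close> by (intro prime_odd_nat) auto
  have "\<forall>l. \<exists>N. l < h \<longrightarrow>
      (\<forall>u v. (\<forall>j<2 * l + 1. [u j = v j] (mod int p)) \<longrightarrow> [N u = N v] (mod int p)) \<and>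
      (\<forall>u v. \<exists>L. (\<forall>i. [(fdiff ^^ (2 * l + 1)) (\<lambda>i. N (\<lambda>j. u j + int i * v j)) i = L] (mod int p)) \<and>
                (int p dvd L \<longrightarrow> (\<forall>j<2 * l + 1. int p dvd v j)))"
  proof
    fix l
    show "\<exists>N. l < h \<longrightarrow>
      (\<forall>u v. (\<forall>j<2 * l + 1. [u j = v j] (mod int p)) \<longrightarrow> [N u = N v] (mod int p)) \<and>
      (\<forall>u v. \<exists>L. (\<forall>i. [(fdiff ^^ (2 * l + 1)) (\<lambda>i. N (\<lambda>j. u j + int i * v j)) i = L] (mod int p)) \<and>
                (int p dvd L \<longrightarrow> (\<forall>j<2 * l + 1. int p dvd v j)))"
    proof (cases "l < h")
      case True
      then have r: "0 < 2 * l + 1" "2 * l + 1 < p" using \<open>p > k\<close> k by auto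
      show ?thesis
        by (rule exists_anisotropic_form[OF \<open>prime p\<close> r]) blast
    qed simp
  qed
  from choice[OF this] obtain N where
    N_cong: "\<And>l u v. l < h \<Longrightarrow> (\<And>j. j < 2 * l + 1 \<Longrightarrow> [u j = v j] (mod int p)) \<Longrightarrow>
          [N l u = N l v] (mod int p)"
    and N_diff: "\<And>l u v. l < h \<Longrightarrow>
          \<exists>L. (\<forall>i. [(fdiff ^^ (2 * l + 1)) (\<lambda>i. N l (\<lambda>j. u j + int i * v j)) i = L] (mod int p)) \<and>
            (int p dvd L \<longrightarrow> (\<forall>j<2 * l + 1. int p dvd v j))"
    by blast
  \<comment> \<open>Block \<open>l\<close> occupies the digits from l^2 to l^2 + 2l. The quotients
    need no reduction modulo \<open>p\<close>, since \<open>N l\<close> depends only on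
    residues.\<close>
  define F where "F y = (\<Sum>l<h. N l (\<lambda>j. y div int p ^ (l\<^sup>2 + j)))" for y :: int
  define arc where "arc y s = int (k - 1) * (y mod int p ^ s) div int p ^ s" for y :: int and s
  \<comment> \<open>Position 0 is omitted because residues modulo 1 carry no information, which
    gives the exponent \<open>m - 1\<close>. Restriction makes the arc vector extensional, so that
    colors lie in the finite set \<open>T\<close>.\<close>
  define col where "col y = (restrict (arc y) {1..<m}, F y mod int p)" for y
  define T where "T = ({1..<m} \<rightarrow>\<^sub>E {0..<int (k - 1)}) \<times> {0..<int p}"
  have finT: "finite T" by (simp add: T_def finite_PiE)
  have cardT: "card T = (k - 1) ^ (m - 1) * p"
    by (simp add: T_def card_cartesian_product card_PiE)
  have col: "col y \<in> T" for y
  proof -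
    have "0 \<le> arc y s" "arc y s < int (k - 1)" for s
    proof -
      have P: "int p ^ s > 0" using p1 by simp
      have "0 \<le> y mod int p ^ s" "y mod int p ^ s < int p ^ s" "int (k - 1) > 0"
        using P k h by auto
      then show "0 \<le> arc y s" "arc y s < int (k - 1)"
        unfolding arc_def by (rule arc_index_range)+
    qed
    then show ?thesis using p1 by (auto simp: col_def T_def)
  qed
  \<comment> \<open>An injective renaming turns the colors into natural numbers.\<close>
  obtain e :: "(nat \<Rightarrow> int) \<times> int \<Rightarrow> nat" where e: "inj_on e T"
    using finite_imp_inj_to_nat_seg[OF finT] by blast
  define c where "c = e \<circ> col"
  have "is_coloring ((k - 1) ^ (m - 1) * p) (carrier (integer_mod_group (p ^ m))) c"
    unfolding is_coloring_def
    by (rule exI[of _ "e ` T"]) (use finT col card_image_le[OF finT, of e] in \<open>auto simp: cardT c_def\<close>)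
  moreover have "\<not> has_nontrivial_symmetrically_colored_AP (integer_mod_group (p ^ m)) c k"
  proof
    assume "has_nontrivial_symmetrically_colored_AP (integer_mod_group (p ^ m)) c k"
    then obtain a d where d: "d \<in> carrier (integer_mod_group (p ^ m))" "d \<noteq> 0"
      and sc: "symmetrically_colored (integer_mod_group (p ^ m)) c k a d"
      unfolding has_nontrivial_symmetrically_colored_AP_def by auto
    define x where "x i = (a + int i * d) mod int p ^ m" for i
    have ap: "ap_term (integer_mod_group (p ^ m)) a d i = x i" for i
      by (simp add: ap_term_def x_def mod_add_right_eq)
    have half: "col (x i) = col (x (k - 1 - i))" if "i < h" for i
    proof -
      have "Suc i \<in> {1..k div 2}" using that k by simp
      then have "c (x (Suc i - 1)) = c (x (k - Suc i))"
        using sc unfolding symmetrically_colored_def ap by blast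
      then show ?thesis using e col by (simp add: c_def inj_on_eq_iff)
    qed
    have sym: "col (x i) = col (x (2 * h - 1 - i))" if i: "i < 2 * h" for i
    proof (cases "i < h")
      case True
      then show ?thesis using half k by simp
    next
      case False
      then have "2 * h - 1 - i < h" "k - 1 - (2 * h - 1 - i) = i" using i k by auto
      then show ?thesis using half[of "2 * h - 1 - i"] by simp
    qed
    have x_cong: "[x i = a + int i * d] (mod int p ^ m)" for i
      by (simp add: x_def cong_def)
    have "\<exists>A D. s < m \<longrightarrow> (\<forall>i<2 * h. x i mod int p ^ s = A + int i * D)" for s
    proof (cases "0 < s \<and> s < m")
      case True
      have P: "int p ^ s > 0" using p1 by simp
      have "\<exists>A D. \<forall>i<2 * h. x i mod int p ^ s = A + int i * D"
      proof (rule progression_in_residues[OF h P])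
        fix i assume i: "i < 2 * h"
        show "0 \<le> x i mod int p ^ s \<and> x i mod int p ^ s < int p ^ s" using P by simp
        have "[x i = a + int i * d] (mod int p ^ s)"
          using x_cong[of i] by (rule cong_dvd_modulus) (use True in \<open>auto intro: le_imp_power_dvd\<close>)
        then show "[x i mod int p ^ s = a + int i * d] (mod int p ^ s)" by simp
        have "arc (x i) s = arc (x (2 * h - 1 - i)) s"
          using sym[OF i] True by (auto simp: col_def restrict_def fun_eq_iff split: if_splits)
        then show "(2 * int h - 1) * (x i mod int p ^ s) div int p ^ s =
            (2 * int h - 1) * (x (2 * h - 1 - i) mod int p ^ s) div int p ^ s"
          using h by (simp add: arc_def k of_nat_diff)
      qed
      then show ?thesis by blast
    next
      case False
      \<comment> \<open>For \<open>s = 0\<close> all residues are 0, so the zero progression serves;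
        for \<open>s\<close> at least \<open>m\<close> nothing is claimed.\<close>
      then show ?thesis by (intro exI[of _ 0]) auto
    qed
    then obtain A D where res: "\<And>i s. i < 2 * h \<Longrightarrow> s < m \<Longrightarrow> x i mod int p ^ s = A s + int i * D s"
      by metis
    obtain \<alpha> \<delta> where dig: "\<And>i s. i < 2 * h \<Longrightarrow> s < m \<Longrightarrow>
          [x i div int p ^ s = \<alpha> s + int i * \<delta> s] (mod int p)"
      and nontriv: "(\<And>s. s < m \<Longrightarrow> int p dvd \<delta> s) \<Longrightarrow> int p ^ m dvd d"
      by (rule progression_in_digits[OF p1 _ x_cong res]) (use h in auto)
    have F: "[F (x i) = (\<Sum>l<h. N l (\<lambda>j. \<alpha> (l\<^sup>2 + j) + int i * \<delta> (l\<^sup>2 + j)))] (mod int p)"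
      if "i < 2 * h" for i
      unfolding F_def using that square_block_less[of _ h]
      by (intro cong_sum N_cong dig) (auto simp: m_def)
    have F_sym: "[F (x i) = F (x (2 * h - 1 - i))] (mod int p)" if "i < 2 * h" for i
      using sym[OF that] by (simp add: col_def cong_def)
    have "int p dvd \<delta> (l\<^sup>2 + j)" if "l < h" "j < 2 * l + 1" for l j
    proof (rule no_symmetric_anisotropic_sum[OF \<open>odd p\<close> \<open>prime p\<close> N_cong N_diff _ that,
          where \<alpha> = "\<lambda>l j. \<alpha> (l\<^sup>2 + j)" and \<delta> = "\<lambda>l j. \<delta> (l\<^sup>2 + j)"])
      fix i assume i: "i < 2 * h"
      then have "2 * h - 1 - i < 2 * h" by simp
      then show "[(\<Sum>l<h. N l (\<lambda>j. \<alpha> (l\<^sup>2 + j) + int i * \<delta> (l\<^sup>2 + j))) =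
          (\<Sum>l<h. N l (\<lambda>j. \<alpha> (l\<^sup>2 + j) + int (2 * h - 1 - i) * \<delta> (l\<^sup>2 + j)))] (mod int p)"
        using F[OF i] F F_sym[OF i] cong_sym cong_trans by meson
    qed
    then have "int p dvd \<delta> s" if "s < m" for s
      using exists_square_block[of s h] that by (auto simp: m_def)
    then have "int p ^ m dvd d" by (rule nontriv)
    moreover have "0 \<le> d" "d < int p ^ m"
      using d p1 by (auto simp: carrier_integer_mod_group)
    ultimately show False using d(2) zdvd_imp_le[of "int p ^ m" d] by simp
  qed
  ultimately show ?thesis unfolding m by blast
qed

end
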